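(* Let $k\geq 1$, $\beta$ integers with $k\geq 2\beta$, $0\leq\beta\leq n$, and let $n\geq 2k+\beta+2$ with $n\equiv \beta \pmod 2$. Let $G$ be a connected simple graph of order $n$ with minimum degree $\delta(G)\geq k$. If $$\mu(\overline{G})\leq \sqrt{(\beta+k+1)(n-k-1)},$$ then $G$ is $\beta$-deficient unless $G\in EP_n$, or $\beta=0$ and $G=K_{k+1}+K_{n-k-1}$.
   Context: For a simple graph $H$, $\overline{H}$ denotes its complement and $\mu(H)$ denotes the spectral radius (largest eigenvalue) of the adjacency matrix of $H$. For disjoint graphs $G_1,G_2$, $G_1+G_2$ denotes their disjoint union, and the join $G_1\vee G_2$ is the graph on $V(G_1)\cup V(G_2)$ whose edges are those of $G_1$, those of $G_2$, and all edges $xy$ with $x\in V(G_1)$, $y\in V(G_2)$. $K_m$ is the complete graph on $m$ vertices. The deficiency $\mathrm{def}(G)$ is the number of vertices left unmatched by a maximum matching of $G$; $G$ is $\beta$-deficient if $\mathrm{def}(G)\leq\beta$. $EP_n$ (depending on $n$ and $k$) is the set of graphs of order $n$ of the form $G_1\vee G_2$, where, for some integer $r$ with $0\le r\le k$, $G_1$ is an $r$-regular graph of order $n-k+r$ and $G_2$ is a spanning subgraph of $K_{k-r}$. *)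

theory Defs
  imports "Graph_Theory.Graph_Theory" "Jordan_Normal_Form.Spectral_Radius"
begin

text \<open>
  Simple graphs are the finite, symmetric, loop-free digraphs of locale \<^const>\<open>pair_graph\<close>: an
  edge between \<open>u\<close> and \<open>v\<close> is represented by the two arcs \<open>(u, v)\<close> and \<open>(v, u)\<close>. Consequently the
  degree of a vertex is its \<^const>\<open>out_degree\<close>. The null graph is allowed.
\<close>

definition complement :: "'a pair_pre_digraph \<Rightarrow> 'a pair_pre_digraph" where
  "complement G = \<lparr>pverts = pverts G,
     parcs = {(u, v). u \<in> pverts G \<and> v \<in> pverts G \<and> u \<noteq> v \<and> (u, v) \<notin> parcs G}\<rparr>"

definition graph_union ::
    "'a pair_pre_digraph \<Rightarrow> 'a pair_pre_digraph \<Rightarrow> 'a pair_pre_digraph" where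
  "graph_union G1 G2 = \<lparr>pverts = pverts G1 \<union> pverts G2, parcs = parcs G1 \<union> parcs G2\<rparr>"

lemma with_proj_graph_union:
  "with_proj (graph_union G1 G2) = Digraph_Component.union (with_proj G1) (with_proj G2)"
  by (simp add: graph_union_def with_proj_def Digraph_Component.union_def)

definition graph_join ::
    "'a pair_pre_digraph \<Rightarrow> 'a pair_pre_digraph \<Rightarrow> 'a pair_pre_digraph" where
  "graph_join G1 G2 = \<lparr>pverts = pverts G1 \<union> pverts G2,
     parcs = parcs G1 \<union> parcs G2 \<union> pverts G1 \<times> pverts G2 \<union> pverts G2 \<times> pverts G1\<rparr>"

definition min_degree :: "'a pair_pre_digraph \<Rightarrow> nat" where
  "min_degree G = Min (out_degree (with_proj G) ` pverts G)"

definition regular :: "nat \<Rightarrow> 'a pair_pre_digraph \<Rightarrow> bool" where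
  "regular r G \<longleftrightarrow> (\<forall>v \<in> pverts G. out_degree (with_proj G) v = r)"


definition adjacency_matrix :: "'a pair_pre_digraph \<Rightarrow> 'a list \<Rightarrow> complex mat" where
  "adjacency_matrix G vs =
     mat (length vs) (length vs) (\<lambda>(i, j). if (vs ! i, vs ! j) \<in> parcs G then 1 else 0)"

text \<open>
  The choice of the enumeration of the vertices is immaterial, see \<open>mu_eq\<close> below.
\<close>

definition mu :: "'a pair_pre_digraph \<Rightarrow> real" where
  "mu G = spectral_radius
     (adjacency_matrix G (SOME vs. distinct vs \<and> set vs = pverts G))"

lemma eigenvalue_adjacency_matrix_iff:
  assumes vs: "distinct vs"
  shows "eigenvalue (adjacency_matrix G vs) z \<longleftrightarrow>
    (\<exists>f. (\<exists>v \<in> set vs. f v \<noteq> 0) \<and>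
         (\<forall>v \<in> set vs. (\<Sum>u \<in> set vs. if (v, u) \<in> parcs G then f u else 0) = z * f v))"
    (is "?L \<longleftrightarrow> ?R")
proof -
  let ?n = "length vs" and ?A = "adjacency_matrix G vs"
  have A: "?A \<in> carrier_mat ?n ?n"
    by (simp add: adjacency_matrix_def)
  have bij: "bij_betw ((!) vs) {0..<?n} (set vs)"
    using vs by (simp add: bij_betw_nth atLeast0LessThan)
  have mult: "(?A *\<^sub>v w) $ i =
      (\<Sum>u \<in> set vs. if (vs ! i, u) \<in> parcs G then f u else 0)"
    if "i < ?n" "w \<in> carrier_vec ?n" "\<And>j. j < ?n \<Longrightarrow> w $ j = f (vs ! j)" for w f i
  proof -
    have "(?A *\<^sub>v w) $ i =
        (\<Sum>j = 0..<?n. if (vs ! i, vs ! j) \<in> parcs G then f (vs ! j) else 0)"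
      using that by (auto simp: adjacency_matrix_def scalar_prod_def intro!: sum.cong)
    also have "\<dots> = (\<Sum>u \<in> set vs. if (vs ! i, u) \<in> parcs G then f u else 0)"
      by (rule sum.reindex_bij_betw[OF bij])
    finally show ?thesis .
  qed
  show ?thesis
  proof
    assume ?L
    then obtain w where w: "w \<in> carrier_vec ?n" "w \<noteq> 0\<^sub>v ?n" "?A *\<^sub>v w = z \<cdot>\<^sub>v w"
      using A by (auto simp: eigenvalue_def eigenvector_def)
    define f where "f v = w $ (THE i. i < ?n \<and> vs ! i = v)" for v
    have f: "w $ j = f (vs ! j)" if "j < ?n" for j
    proof -
      have "(THE i. i < ?n \<and> vs ! i = vs ! j) = j"
        using that vs by (intro the_equality) (auto simp: nth_eq_iff_index_eq)
      then show ?thesis by (simp add: f_def)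
    qed
    obtain i where i: "i < ?n" "w $ i \<noteq> 0"
      using w(1,2) by (metis carrier_vecD eq_vecI index_zero_vec)
    have "(\<Sum>u \<in> set vs. if (v, u) \<in> parcs G then f u else 0) = z * f v"
      if v: "v \<in> set vs" for v
    proof -
      obtain j where j: "j < ?n" "v = vs ! j"
        using v by (metis in_set_conv_nth)
      then show ?thesis
        using mult[OF j(1) w(1) f] w(1) f[OF j(1)] j(2) by (simp add: w(3))
    qed
    then show ?R
      using i f by (intro exI[of _ f]) (auto intro!: bexI[of _ "vs ! i"])
  next
    assume ?R
    then obtain f v where f: "v \<in> set vs" "f v \<noteq> 0"
      "\<And>v. v \<in> set vs \<Longrightarrow> (\<Sum>u \<in> set vs. if (v, u) \<in> parcs G then f u else 0) = z * f v"
      by blast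
    define w where "w = vec ?n (\<lambda>i. f (vs ! i))"
    have w: "w \<in> carrier_vec ?n" "\<And>j. j < ?n \<Longrightarrow> w $ j = f (vs ! j)"
      by (simp_all add: w_def)
    obtain j where j: "j < ?n" "v = vs ! j"
      using f(1) by (metis in_set_conv_nth)
    have "w \<noteq> 0\<^sub>v ?n"
      using f(2) j w(2)[OF j(1)] by auto
    moreover have "?A *\<^sub>v w = z \<cdot>\<^sub>v w"
    proof (rule eq_vecI)
      show "dim_vec (?A *\<^sub>v w) = dim_vec (z \<cdot>\<^sub>v w)"
        using A w(1) by simp
    next
      fix i assume "i < dim_vec (z \<cdot>\<^sub>v w)"
      then have "i < ?n" using w(1) by simp
      then show "(?A *\<^sub>v w) $ i = (z \<cdot>\<^sub>v w) $ i"
        using mult[OF \<open>i < length vs\<close> w] w f(3)[of "vs ! i"] by simp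
    qed
    ultimately show ?L
      using A w(1) by (auto simp: eigenvalue_def eigenvector_def)
  qed
qed

lemma mu_eq:
  assumes "distinct vs" "set vs = pverts G"
  shows "mu G = spectral_radius (adjacency_matrix G vs)"
proof -
  define us where "us = (SOME vs. distinct vs \<and> set vs = pverts G)"
  have "distinct us \<and> set us = pverts G"
    unfolding us_def by (rule someI[of _ vs]) (use assms in simp)
  then have "spectrum (adjacency_matrix G us) = spectrum (adjacency_matrix G vs)"
    using assms by (auto simp: spectrum_def eigenvalue_adjacency_matrix_iff)
  then show ?thesis
    by (simp add: mu_def us_def spectral_radius_def)
qed


definition edges :: "'a pair_pre_digraph \<Rightarrow> 'a set set" where
  "edges G = {{u, v} | u v. (u, v) \<in> parcs G}"

definition matching :: "'a pair_pre_digraph \<Rightarrow> 'a set set \<Rightarrow> bool" where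
  "matching G M \<longleftrightarrow> M \<subseteq> edges G \<and> pairwise disjnt M"

definition maximum_matching :: "'a pair_pre_digraph \<Rightarrow> 'a set set \<Rightarrow> bool" where
  "maximum_matching G M \<longleftrightarrow> matching G M \<and> (\<forall>M'. matching G M' \<longrightarrow> card M' \<le> card M)"

text \<open>
  All maximum matchings leave the same number of vertices unmatched.
\<close>

definition deficiency :: "'a pair_pre_digraph \<Rightarrow> nat" where
  "deficiency G = card (pverts G - \<Union>(SOME M. maximum_matching G M))"

definition deficient :: "nat \<Rightarrow> 'a pair_pre_digraph \<Rightarrow> bool" where
  "deficient \<beta> G \<longleftrightarrow> deficiency G \<le> \<beta>"


text \<open>
  Since the two parts range over all graphs with vertices in the ambient type, the equations with
  \<open>G\<close> in the following two definitions describe isomorphism classes. The symmetry of \<open>G2\<close> has to be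
  demanded because \<^const>\<open>spanning\<close> is about directed subgraphs.
\<close>

definition EP :: "nat \<Rightarrow> nat \<Rightarrow> 'a pair_pre_digraph set" where
  "EP n k = {G. card (pverts G) = n \<and>
     (\<exists>r G1 G2 K. r \<le> k \<and>
        pair_graph G1 \<and> card (pverts G1) = n - k + r \<and> regular r G1 \<and>
        pair_graph G2 \<and> complete_digraph (k - r) (with_proj K) \<and>
        spanning (with_proj G2) (with_proj K) \<and>
        pverts G1 \<inter> pverts G2 = {} \<and> G = graph_join G1 G2)}"

definition is_union_of_complete :: "nat \<Rightarrow> nat \<Rightarrow> 'a pair_pre_digraph \<Rightarrow> bool" where
  "is_union_of_complete a b G \<longleftrightarrow>
     (\<exists>G1 G2. complete_digraph a (with_proj G1) \<and> complete_digraph b (with_proj G2) \<and>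
        pverts G1 \<inter> pverts G2 = {} \<and> G = graph_union G1 G2)"

end

theory Submission
  imports Defs
begin

text \<open>
  Let \<open>n - \<beta> = 2 s\<close>. If \<open>G\<close> is not \<open>\<beta>\<close>-deficient, it has no matching of size \<open>s\<close>; let \<open>H\<close> be an
  edge-maximal supergraph of \<open>G\<close> with this property. Adding a missing edge \<open>uv\<close> to \<open>H\<close> creates a
  matching of size \<open>s\<close>, and an augmentation argument gives \<open>d\<^sub>H u + d\<^sub>H v \<le> n - \<beta> - 2\<close>. Hence in
  the complement of \<open>H\<close> adjacent vertices have degrees at most \<open>b = n - k - 1\<close> with sum at least
  \<open>a + b\<close>, where \<open>a = \<beta> + k + 1\<close>, so their product is at least \<open>a b\<close>. Testing the quadratic form of
  the complement of \<open>G\<close> on the vector of square roots of these degrees shows that its spectral radius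
  is at least \<open>sqrt (a b)\<close>, with equality only if every edge of the complement of \<open>H\<close> joins degrees
  \<open>a\<close> and \<open>b\<close>. If \<open>a = b\<close>, the complement of \<open>H\<close> is regular apart from isolated vertices and \<open>G\<close>
  lies in \<open>EP n k\<close>. If \<open>a < b\<close>, it is complete bipartite and spanning, so \<open>G\<close> is disconnected.
\<close>


section \<open>Spectral radius and quadratic forms of symmetric matrices\<close>

text \<open>
  If the Rayleigh quotient of \<open>x\<close> exceeds some \<open>c\<close> above the spectral
  radius, the powers of \<open>A / c\<close> are bounded, whereas by Cauchy--Schwarz the moments
  \<open>x\<^sup>T (A / c)\<^sup>p x\<close> grow at least geometrically along \<open>p = 2\<^sup>e\<close>.
\<close>

lemma real_quadratic_form_le_spectral_radius:
  fixes a :: "nat \<Rightarrow> nat \<Rightarrow> real" and x :: "nat \<Rightarrow> real"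
  assumes n: "n > 0" and sym: "\<And>i j. i < n \<Longrightarrow> j < n \<Longrightarrow> a i j = a j i"
  shows "(\<Sum>i<n. \<Sum>j<n. a i j * x i * x j) \<le>
    spectral_radius (mat n n (\<lambda>(i, j). complex_of_real (a i j))) * (\<Sum>i<n. (x i)\<^sup>2)"
proof (rule ccontr)
  define A where "A = mat n n (\<lambda>(i, j). complex_of_real (a i j))"
  define Q where "Q = (\<Sum>i<n. \<Sum>j<n. a i j * x i * x j)"
  define N where "N = (\<Sum>i<n. (x i)\<^sup>2)"
  have A: "A \<in> carrier_mat n n"
    by (simp add: A_def)
  assume "\<not> ?thesis"
  then have less: "spectral_radius A * N < Q"
    by (simp add: A_def Q_def N_def)
  have rho: "spectral_radius A \<ge> 0"
    using spectral_radius_mem_max(1)[OF A n] by auto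
  have "N \<ge> 0"
    by (simp add: N_def sum_nonneg)
  moreover have "N \<noteq> 0"
  proof
    assume "N = 0"
    then have "x i = 0" if "i < n" for i
      using that by (simp add: N_def sum_nonneg_eq_0_iff)
    then have "Q = 0"
      by (simp add: Q_def)
    then show False
      using less \<open>N = 0\<close> by simp
  qed
  ultimately have N: "N > 0" by simp
  then have "spectral_radius A < Q / N"
    using less by (simp add: field_simps)
  \<comment> \<open>Scaling by a \<open>c\<close> strictly between the spectral radius and the
    Rayleigh quotient makes \<open>B = A / c\<close> a contraction asymptotically, while its
    Rayleigh quotient at \<open>x\<close> still exceeds 1.\<close>
  then obtain c where c: "spectral_radius A < c" "c < Q / N"
    using dense by blast
  then have c0: "c > 0" using rho by linarith
  define T where "T y i = (\<Sum>j<n. a i j / c * y j)" for y :: "nat \<Rightarrow> real" and i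
  define B where "B = mat n n (\<lambda>(i, j). complex_of_real (a i j / c))"
  have B: "B \<in> carrier_mat n n"
    by (simp add: B_def)
  have AB: "A = complex_of_real c \<cdot>\<^sub>m B"
    using c0 by (auto simp: A_def B_def)
  have "spectral_radius B < 1"
  proof -
    obtain z where z: "z \<in> spectrum B" "spectral_radius B = norm z"
      using spectral_radius_mem_max(1)[OF B n] by auto
    then obtain v where v: "v \<in> carrier_vec n" "v \<noteq> 0\<^sub>v n" "B *\<^sub>v v = z \<cdot>\<^sub>v v"
      using B by (auto simp: spectrum_def eigenvalue_def eigenvector_def)
    then have "A *\<^sub>v v = (complex_of_real c * z) \<cdot>\<^sub>v v"
    proof (intro eq_vecI)
      fix i assume "i < dim_vec ((complex_of_real c * z) \<cdot>\<^sub>v v)"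
      then have "i < n" using v by simp
      then have "row B i \<bullet> v = (B *\<^sub>v v) $ i" using B by simp
      also have "\<dots> = z * v $ i" unfolding v(3) using \<open>i < n\<close> v(1) by simp
      finally show "(A *\<^sub>v v) $ i = ((complex_of_real c * z) \<cdot>\<^sub>v v) $ i"
        using \<open>i < n\<close> v(1) B by (simp add: AB)
    qed (use A v in simp)
    \<comment> \<open>An eigenvalue of \<open>B\<close> times \<open>c\<close> is an eigenvalue of
      \<open>A\<close>, so its modulus is below \<open>c\<close>.\<close>
    then have "complex_of_real c * z \<in> spectrum A"
      using v A by (auto simp: spectrum_def eigenvalue_def eigenvector_def)
    then have "norm (complex_of_real c * z) \<le> spectral_radius A"
      using spectral_radius_mem_max(2)[OF A n] by blast
    then have "c * norm z \<le> spectral_radius A"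
      using c0 by (simp add: norm_mult)
    then have "c * norm z < c * 1"
      using c(1) by linarith
    then show ?thesis
      using c0 z by simp
  qed
  \<comment> \<open>A spectral radius below 1 bounds the entries of all powers by one constant, via
    the Jordan normal form.\<close>
  then obtain C where C: "\<And>p. norm_bound (B ^\<^sub>m p) C"
    using spectral_radius_jnf_norm_bound_less_1_upper_triangular[OF B] by blast
  have pow: "B ^\<^sub>m p *\<^sub>v vec n (\<lambda>i. complex_of_real (y i)) = vec n (\<lambda>i. complex_of_real ((T ^^ p) y i))"
    for p y
  proof (induction p arbitrary: y)
    case 0
    then show ?case using B by simp
  next
    case (Suc p)
    have "B *\<^sub>v vec n (\<lambda>i. complex_of_real (y i)) = vec n (\<lambda>i. complex_of_real (T y i))"
      by (rule eq_vecI) (auto simp: B_def T_def scalar_prod_def atLeast0LessThan)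
    then show ?case
      using B Suc[of "T y"] assoc_mult_mat_vec[OF pow_carrier_mat[OF B] B, of _ p]
      by (simp add: funpow_swap1)
  qed
  define M where "M p = (\<Sum>i<n. x i * (T ^^ p) x i)" for p
  have adj: "(\<Sum>i<n. T y i * z i) = (\<Sum>i<n. y i * T z i)" for y z
  proof -
    have "(\<Sum>i<n. T y i * z i) = (\<Sum>i<n. \<Sum>j<n. a i j / c * y j * z i)"
      by (simp add: T_def sum_distrib_right)
    also have "\<dots> = (\<Sum>j<n. \<Sum>i<n. a i j / c * y j * z i)"
      by (rule sum.swap)
    also have "\<dots> = (\<Sum>j<n. y j * T z j)"
      unfolding T_def sum_distrib_left using sym by (intro sum.cong) auto
    finally show ?thesis .
  qed
  have adj_pow: "(\<Sum>i<n. (T ^^ p) y i * z i) = (\<Sum>i<n. y i * (T ^^ p) z i)" for p y z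
  proof (induction p arbitrary: z)
    case (Suc p)
    have "(\<Sum>i<n. (T ^^ Suc p) y i * z i) = (\<Sum>i<n. (T ^^ p) y i * T z i)"
      by (simp add: adj)
    also have "\<dots> = (\<Sum>i<n. y i * (T ^^ Suc p) z i)"
      by (simp add: Suc.IH funpow_swap1)
    finally show ?case .
  qed simp
  \<comment> \<open>Cauchy--Schwarz for \<open>x\<close> and \<open>(T ^^ p) x\<close>, obtained by
    expanding a sum of squares; self-adjointness turns the squared norm of \<open>(T ^^ p) x\<close>
    into the moment \<open>M (2 * p)\<close>.\<close>
  have M_double: "(M p)\<^sup>2 \<le> M (2 * p) * N" for p
  proof -
    have "0 \<le> (\<Sum>i<n. (N * (T ^^ p) x i - M p * x i)\<^sup>2)"
      by (simp add: sum_nonneg)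
    also have "\<dots> = (\<Sum>i<n. N\<^sup>2 * ((T ^^ p) x i)\<^sup>2 - 2 * N * M p * (x i * (T ^^ p) x i) + (M p)\<^sup>2 * (x i)\<^sup>2)"
      by (rule sum.cong) (auto simp: power2_eq_square algebra_simps)
    also have "\<dots> = N\<^sup>2 * (\<Sum>i<n. ((T ^^ p) x i)\<^sup>2) - 2 * N * M p * M p + (M p)\<^sup>2 * N"
      by (simp add: sum.distrib sum_subtractf sum_distrib_left M_def N_def)
    also have "\<dots> = N * (N * (\<Sum>i<n. ((T ^^ p) x i)\<^sup>2) - (M p)\<^sup>2)"
      by (simp add: power2_eq_square algebra_simps)
    finally have "(M p)\<^sup>2 \<le> N * (\<Sum>i<n. ((T ^^ p) x i)\<^sup>2)"
      using N by (simp add: zero_le_mult_iff)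
    also have "(\<Sum>i<n. ((T ^^ p) x i)\<^sup>2) = M (2 * p)"
      using adj_pow[of p x "(T ^^ p) x"] by (simp add: M_def power2_eq_square mult_2 funpow_add)
    finally show ?thesis by (simp add: mult.commute)
  qed
  define q where "q = M 1 / N"
  have "M 1 = Q / c"
    by (simp add: M_def T_def Q_def sum_distrib_left sum_divide_distrib mult_ac)
  then have q_eq: "q = Q / N / c"
    by (simp add: q_def)
  have q: "q > 1"
    unfolding q_eq using c(2) c0 by (simp only: less_divide_eq_1_pos)
  have growth: "q ^ (2 ^ e) \<le> M (2 ^ e) / N" for e
  proof (induction e)
    case 0
    then show ?case by (simp add: q_def)
  next
    case (Suc e)
    have "q ^ (2 ^ Suc e) = (q ^ (2 ^ e))\<^sup>2"
      by (simp add: power_mult[symmetric] mult.commute)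
    also have "\<dots> \<le> (M (2 ^ e) / N)\<^sup>2"
      using Suc q by (intro power_mono) auto
    also have "\<dots> \<le> M (2 ^ Suc e) / N"
      using M_double[of "2 ^ e"] N by (simp add: field_simps power2_eq_square)
    finally show ?case .
  qed
  define S where "S = (\<Sum>i<n. \<bar>x i\<bar>)"
  have entry: "(P *\<^sub>v vec n g) $ i = (\<Sum>j<n. P $$ (i, j) * g j)"
    if "P \<in> carrier_mat n n" "i < n" for P :: "complex mat" and g i
    using that by (auto simp: scalar_prod_def atLeast0LessThan)
  have bound: "M p \<le> S * (C * S)" for p
  proof -
    have T_bound: "\<bar>(T ^^ p) x i\<bar> \<le> C * S" if i: "i < n" for i
    proof -
      have "complex_of_real ((T ^^ p) x i) = (B ^\<^sub>m p *\<^sub>v vec n (\<lambda>i. complex_of_real (x i))) $ i"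
        using i by (simp add: pow)
      also have "\<dots> = (\<Sum>j<n. (B ^\<^sub>m p) $$ (i, j) * complex_of_real (x j))"
        by (rule entry[OF pow_carrier_mat[OF B] i])
      finally have "\<bar>(T ^^ p) x i\<bar> = norm (\<Sum>j<n. (B ^\<^sub>m p) $$ (i, j) * complex_of_real (x j))"
        by (metis norm_of_real)
      also have "\<dots> \<le> (\<Sum>j<n. C * \<bar>x j\<bar>)"
      proof (rule sum_norm_le)
        fix j assume "j \<in> {..<n}"
        then have "norm ((B ^\<^sub>m p) $$ (i, j)) \<le> C"
          using C[of p] i carrier_matD[OF pow_carrier_mat[OF B, of p]] by (simp add: norm_bound_def)
        then show "norm ((B ^\<^sub>m p) $$ (i, j) * complex_of_real (x j)) \<le> C * \<bar>x j\<bar>"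
          by (simp add: norm_mult mult_right_mono)
      qed
      finally show ?thesis by (simp add: S_def sum_distrib_left)
    qed
    have "M p \<le> (\<Sum>i<n. \<bar>x i\<bar> * (C * S))"
      unfolding M_def
    proof (rule sum_mono)
      fix i assume "i \<in> {..<n}"
      then have "\<bar>x i\<bar> * \<bar>(T ^^ p) x i\<bar> \<le> \<bar>x i\<bar> * (C * S)"
        using T_bound by (intro mult_left_mono) auto
      then show "x i * (T ^^ p) x i \<le> \<bar>x i\<bar> * (C * S)"
        by (metis abs_le_D1 abs_mult)
    qed
    also have "\<dots> = S * (C * S)"
      by (simp add: S_def sum_distrib_right)
    finally show ?thesis .
  qed
  \<comment> \<open>Growth is known only along powers of two; \<open>e \<le> 2 ^ e\<close> makes
    this enough.\<close>
  obtain e where e: "S * (C * S) / N < q ^ e"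
    using q real_arch_pow by blast
  also have "\<dots> \<le> q ^ (2 ^ e)"
    using q by (intro power_increasing) (auto intro: less_imp_le)
  also have "\<dots> \<le> M (2 ^ e) / N"
    by (rule growth)
  also have "\<dots> \<le> S * (C * S) / N"
    using bound N by (simp add: divide_right_mono)
  finally show False by simp
qed

lemma pair_graph_iff:
  "pair_graph G \<longleftrightarrow> finite (pverts G) \<and> parcs G \<subseteq> pverts G \<times> pverts G \<and>
     sym (parcs G) \<and> irrefl (parcs G)" (is "?L \<longleftrightarrow> ?R")
proof
  assume ?L
  then interpret pair_graph G .
  show ?R
    using pair_finite_verts pair_no_loops pair_sym_arcs
    by (fastforce simp: symmetric_def irrefl_def dest: in_arcsD1 in_arcsD2)
next
  assume R: ?R
  then have "finite (parcs G)"
    by (meson finite_SigmaI finite_subset)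
  then show ?L
    using R by unfold_locales (auto simp: symmetric_def irrefl_def)
qed

text \<open>The sum over arcs is the quadratic form of the adjacency matrix, since an edge
  contributes both of its arcs. A vertex is needed because the spectral radius of an empty matrix is
  a maximum over the empty set.\<close>

lemma sum_arcs_le_mu:
  fixes f :: "'a \<Rightarrow> real"
  assumes G: "pair_graph G" and ne: "pverts G \<noteq> {}"
  shows "(\<Sum>(u, v) \<in> parcs G. f u * f v) \<le> mu G * (\<Sum>v \<in> pverts G. (f v)\<^sup>2)"
proof -
  have fin: "finite (pverts G)" and sub: "parcs G \<subseteq> pverts G \<times> pverts G" and sym: "sym (parcs G)"
    using G by (auto simp: pair_graph_iff)
  obtain vs where vs: "set vs = pverts G" "distinct vs"
    using finite_distinct_list[OF fin] by blast
  let ?n = "length vs"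
  define a :: "nat \<Rightarrow> nat \<Rightarrow> real" where "a i j = (if (vs ! i, vs ! j) \<in> parcs G then 1 else 0)" for i j
  have bij: "bij_betw ((!) vs) {..<?n} (pverts G)"
    using vs bij_betw_nth by blast
  have "adjacency_matrix G vs = mat ?n ?n (\<lambda>(i, j). complex_of_real (a i j))"
    by (auto simp: adjacency_matrix_def a_def)
  then have mu: "mu G = spectral_radius (mat ?n ?n (\<lambda>(i, j). complex_of_real (a i j)))"
    using mu_eq[of vs G] vs by simp
  have "(\<Sum>(u, v) \<in> parcs G. f u * f v) =
      (\<Sum>(u, v) \<in> pverts G \<times> pverts G. if (u, v) \<in> parcs G then f u * f v else 0)"
    using fin sub by (intro sum.mono_neutral_cong_left) auto
  also have "\<dots> = (\<Sum>u \<in> pverts G. \<Sum>v \<in> pverts G. if (u, v) \<in> parcs G then f u * f v else 0)"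
    by (simp add: sum.cartesian_product)
  also have "\<dots> = (\<Sum>i<?n. \<Sum>j<?n. a i j * f (vs ! i) * f (vs ! j))"
    by (simp add: sum.reindex_bij_betw[OF bij, symmetric] a_def if_distrib if_distribR cong: if_cong)
  also have "\<dots> \<le> mu G * (\<Sum>i<?n. (f (vs ! i))\<^sup>2)"
    unfolding mu
  proof (rule real_quadratic_form_le_spectral_radius)
    show "0 < ?n" using ne vs by auto
    show "a i j = a j i" for i j
      using sym by (auto simp: a_def dest: symD)
  qed
  also have "(\<Sum>i<?n. (f (vs ! i))\<^sup>2) = (\<Sum>v \<in> pverts G. (f v)\<^sup>2)"
    by (rule sum.reindex_bij_betw[OF bij])
  finally show ?thesis .
qed


section \<open>Matchings, augmentation and deficiency\<close>

lemma pair_graphD: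
  assumes "pair_graph G"
  shows "finite (pverts G)" "finite (parcs G)"
    "(u, v) \<in> parcs G \<Longrightarrow> u \<in> pverts G" "(u, v) \<in> parcs G \<Longrightarrow> v \<in> pverts G"
    "(u, v) \<in> parcs G \<Longrightarrow> (v, u) \<in> parcs G" "(u, v) \<in> parcs G \<Longrightarrow> u \<noteq> v"
  using assms unfolding pair_graph_iff
  by (auto simp: irrefl_def dest: symD intro: finite_subset[OF _ finite_cartesian_product])

lemma out_degree_eq_card_Image: "out_degree (with_proj G) v = card (parcs G `` {v})"
proof -
  have "out_arcs (with_proj G) v = Pair v ` (parcs G `` {v})"
    by (auto simp: out_arcs_def)
  then show ?thesis
    by (simp add: out_degree_def card_image inj_on_def)
qed

lemma matchingD:
  assumes G: "pair_graph G" and M: "matching G M"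
  shows "finite M" "\<Union>M \<subseteq> pverts G" "e \<in> M \<Longrightarrow> card e = 2" "card (\<Union>M) = 2 * card M"
proof -
  note D = pair_graphD[OF G]
  have e: "\<exists>u v. e = {u, v} \<and> (u, v) \<in> parcs G" if "e \<in> M" for e
    using M that by (auto simp: matching_def edges_def)
  show sub: "\<Union>M \<subseteq> pverts G"
    using e D(3,4) by blast
  then have "M \<subseteq> Pow (pverts G)" by blast
  then show "finite M"
    using D(1) finite_subset by blast
  show card2: "card e = 2" if "e \<in> M" for e
    using e[OF that] D(6) by fastforce
  have "card (\<Union>M) = sum card M"
    using M sub D(1) by (intro card_Union_disjoint)
      (auto simp: matching_def intro: finite_subset)
  then show "card (\<Union>M) = 2 * card M"
    using card2 by simp
qed

lemma matching_subset: "matching G M \<Longrightarrow> M' \<subseteq> M \<Longrightarrow> matching G M'"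
  by (auto simp: matching_def intro: pairwise_subset)

lemma matching_not_in_Union_Diff: "matching G M \<Longrightarrow> e \<in> M \<Longrightarrow> x \<in> e \<Longrightarrow> x \<notin> \<Union>(M - {e})"
  unfolding matching_def pairwise_def disjnt_def by blast

lemma matching_insert:
  assumes G: "pair_graph G" and M: "matching G M" and arc: "(u, v) \<in> parcs G"
    and uv: "u \<notin> \<Union>M" "v \<notin> \<Union>M"
  shows "matching G (insert {u, v} M)" "card (insert {u, v} M) = Suc (card M)"
proof -
  show "matching G (insert {u, v} M)"
    using M arc uv by (auto simp: matching_def edges_def pairwise_insert disjnt_def)
  show "card (insert {u, v} M) = Suc (card M)"
    using matchingD(1)[OF G M] uv by (subst card_insert_disjoint) auto
qed

text \<open>Flipping the augmenting path \<open>u\<close>, \<open>x\<close>, \<open>y\<close>,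
  \<open>v\<close>: the edge \<open>xy\<close> is replaced by \<open>ux\<close> and
  \<open>vy\<close>.\<close>

lemma matching_augment:
  assumes G: "pair_graph G" and M: "matching G M" and xy: "{x, y} \<in> M"
    and arcs: "(u, x) \<in> parcs G" "(v, y) \<in> parcs G"
    and uv: "u \<noteq> v" "u \<notin> \<Union>M" "v \<notin> \<Union>M"
  shows "\<exists>M'. matching G M' \<and> card M' = Suc (card M)"
proof -
  define M0 where "M0 = M - {{x, y}}"
  have M0: "matching G M0"
    using M by (auto simp: M0_def intro: matching_subset)
  have cM: "card M = Suc (card M0)"
    using card_Suc_Diff1[OF matchingD(1)[OF G M] xy] by (simp add: M0_def)
  have "x \<noteq> y"
    using matchingD(3)[OF G M xy] by auto
  have "x \<notin> \<Union>M0" "y \<notin> \<Union>M0"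
    using matching_not_in_Union_Diff[OF M xy] unfolding M0_def by blast+
  moreover have "u \<notin> \<Union>M0" "v \<notin> \<Union>M0" "u \<noteq> y" "v \<noteq> x"
    using uv xy by (auto simp: M0_def)
  ultimately have M1: "matching G (insert {u, x} M0)" "card (insert {u, x} M0) = Suc (card M0)"
    and "v \<notin> \<Union>(insert {u, x} M0)" "y \<notin> \<Union>(insert {u, x} M0)"
    using matching_insert[OF G M0 arcs(1)] uv \<open>x \<noteq> y\<close> by auto
  then show ?thesis
    using matching_insert[OF G M1(1) arcs(2)] cM by metis
qed

text \<open>All neighbours of \<open>u\<close> and \<open>v\<close> are covered by \<open>M\<close>,
  since otherwise an edge could be inserted. Each edge of \<open>M\<close> receives at most two arcs
  from \<open>u\<close> and \<open>v\<close> together, since otherwise an augmenting path of length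
  three would exist.\<close>

lemma degree_sum_le_of_unmatched:
  assumes G: "pair_graph G" and M: "matching G M"
    and max: "\<nexists>M'. matching G M' \<and> card M' = Suc (card M)"
    and uv: "u \<noteq> v" "u \<notin> \<Union>M" "v \<notin> \<Union>M"
  shows "card (parcs G `` {u}) + card (parcs G `` {v}) \<le> 2 * card M"
proof -
  note D = pair_graphD[OF G]
  have card_nbs: "card (parcs G `` {w}) = (\<Sum>e\<in>M. card (parcs G `` {w} \<inter> e))" if w: "w \<notin> \<Union>M" for w
  proof -
    have "parcs G `` {w} \<subseteq> \<Union>M"
      using matching_insert[OF G M _ w] max by blast
    then have "parcs G `` {w} = (\<Union>e\<in>M. parcs G `` {w} \<inter> e)"
      by blast
    also have "card \<dots> = (\<Sum>e\<in>M. card (parcs G `` {w} \<inter> e))"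
      using matchingD(1)[OF G M] M D(2)
      by (intro card_UN_disjoint) (auto simp: matching_def pairwise_def disjnt_def)
    finally show ?thesis .
  qed
  have "card (parcs G `` {u} \<inter> e) + card (parcs G `` {v} \<inter> e) \<le> 2" if e: "e \<in> M" for e
  proof -
    obtain x y where xy: "e = {x, y}" "x \<noteq> y"
      using matchingD(3)[OF G M e] by (auto simp: card_2_iff)
    have no: "\<not> ((u, x) \<in> parcs G \<and> (v, y) \<in> parcs G)" "\<not> ((u, y) \<in> parcs G \<and> (v, x) \<in> parcs G)"
      using matching_augment[OF G M, of x y u v] matching_augment[OF G M, of y x u v] e uv max xy
      by (auto simp: insert_commute)
    have "card (parcs G `` {w} \<inter> e) =
        (if (w, x) \<in> parcs G then 1 else 0) + (if (w, y) \<in> parcs G then 1 else 0)" for w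
      using xy by (auto simp: Int_insert_right)
    then show ?thesis
      using no by auto
  qed
  then have "(\<Sum>e\<in>M. card (parcs G `` {u} \<inter> e) + card (parcs G `` {v} \<inter> e)) \<le> (\<Sum>e\<in>M. 2)"
    by (rule sum_mono)
  then show ?thesis
    using card_nbs uv by (simp add: sum.distrib)
qed

text \<open>The matching chosen in \<open>deficiency\<close> is maximum, because sizes of matchings
  are bounded, and hence at least as large as \<open>M\<close>.\<close>

lemma deficiency_le:
  assumes G: "pair_graph G" and M: "matching G M"
  shows "deficiency G \<le> card (pverts G) - 2 * card M"
proof -
  have "matching G M' \<Longrightarrow> card M' \<le> card (pverts G)" for M'
    using matchingD[OF G, of M'] card_mono[OF pair_graphD(1)[OF G], of "\<Union>M'"] by auto
  then have "\<exists>M. maximum_matching G M"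
    using ex_has_greatest_nat[of "matching G" M card "Suc (card (pverts G))"] M
    unfolding maximum_matching_def by (metis less_Suc_eq_le)
  define N where "N = (SOME M. maximum_matching G M)"
  have "maximum_matching G N"
    unfolding N_def by (rule someI_ex) fact
  then have N: "matching G N" "card M \<le> card N"
    using M by (auto simp: maximum_matching_def)
  have "deficiency G = card (pverts G) - 2 * card N"
    using matchingD[OF G N(1)] pair_graphD(1)[OF G]
    by (simp add: deficiency_def N_def[symmetric] card_Diff_subset finite_subset)
  then show ?thesis
    using N(2) by simp
qed

text \<open>
  Edge-maximality plays the role of the Bondy--Chvatal closure: the degree condition on
  non-adjacent vertices is read off a matching that becomes available when the edge is added.
\<close>

lemma edge_maximal_without_matching:
  assumes G: "pair_graph G" and no: "\<nexists>M. matching G M \<and> card M = s"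
    and s: "2 * s \<le> card (pverts G)"
  obtains H where "pair_graph H" "pverts H = pverts G" "parcs G \<subseteq> parcs H"
    "parcs (complement H) \<noteq> {}"
    "\<And>u v. (u, v) \<in> parcs (complement H) \<Longrightarrow>
       card (parcs H `` {u}) + card (parcs H `` {v}) + 2 \<le> 2 * s"
proof -
  define V where "V = pverts G"
  have finV: "finite V"
    using G by (simp add: V_def pair_graph_iff)
  define P where "P E \<longleftrightarrow> pair_graph \<lparr>pverts = V, parcs = E\<rparr> \<and>
    (\<nexists>M. matching \<lparr>pverts = V, parcs = E\<rparr> M \<and> card M = s)" for E
  have "finite {E. P E}"
    by (rule finite_subset[of _ "Pow (V \<times> V)"]) (auto simp: P_def pair_graph_iff finV)
  moreover have "P (parcs G)"
    using G no by (simp add: P_def V_def pair_graph_iff matching_def edges_def)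
  ultimately obtain E where E: "P E" "parcs G \<subseteq> E" and max: "\<And>E'. P E' \<Longrightarrow> E \<subseteq> E' \<Longrightarrow> E' = E"
    using finite_has_maximal2[of "{E. P E}" "parcs G"] by auto
  define H where "H = \<lparr>pverts = V, parcs = E\<rparr>"
  have H: "pair_graph H" and noH: "\<nexists>M. matching H M \<and> card M = s"
    using E by (auto simp: P_def H_def)
  show thesis
  proof
    show "pair_graph H" by (rule H)
    show "pverts H = pverts G" "parcs G \<subseteq> parcs H"
      using E by (auto simp: H_def V_def)
    show "parcs (complement H) \<noteq> {}"
    proof
      assume empty: "parcs (complement H) = {}"
      \<comment> \<open>If \<open>H\<close> were complete, a matching of size \<open>s\<close> could
        be built greedily: before the last edge is chosen, at least two vertices are still
        free.\<close>
      have "\<exists>M. matching H M \<and> card M = t" if "t \<le> s" for t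
        using that
      proof (induction t)
        case 0
        have "matching H {}" by (simp add: matching_def)
        then show ?case by (intro exI[of _ "{}"]) simp
      next
        case (Suc t)
        then obtain M where M: "matching H M" "card M = t" by auto
        have "card (V - \<Union>M) \<ge> 2"
          using matchingD[OF H M(1)] M(2) Suc.prems s finV
          by (simp add: H_def V_def[symmetric] card_Diff_subset finite_subset)
        then obtain u v where uv: "u \<in> V - \<Union>M" "v \<in> V - \<Union>M" "u \<noteq> v"
          using card_le_Suc0_iff_eq[of "V - \<Union>M"] finV by auto
        then have "(u, v) \<in> parcs H"
          using empty by (auto simp: complement_def H_def)
        then show ?case
          using matching_insert[OF H M(1), of u v] uv M(2) by blast
      qed
      then show False using noH by blast
    qed
    fix u v assume uv: "(u, v) \<in> parcs (complement H)"
    then have uvE: "u \<in> V" "v \<in> V" "u \<noteq> v" "(u, v) \<notin> E"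
      by (auto simp: complement_def H_def)
    define E' where "E' = insert (u, v) (insert (v, u) E)"
    have "\<not> P E'"
      using max[of E'] uvE by (auto simp: E'_def)
    moreover have "pair_graph \<lparr>pverts = V, parcs = E'\<rparr>"
      using H uvE by (auto simp: pair_graph_iff H_def E'_def sym_def irrefl_def)
    ultimately obtain M where M: "matching \<lparr>pverts = V, parcs = E'\<rparr> M" "card M = s"
      by (auto simp: P_def)
    have edges: "edges \<lparr>pverts = V, parcs = E'\<rparr> = insert {u, v} (edges H)"
      by (auto simp: edges_def E'_def H_def)
    define M0 where "M0 = M - {{u, v}}"
    have M0: "matching H M0"
      using M(1) edges by (auto simp: matching_def M0_def intro: pairwise_subset)
    \<comment> \<open>Without the new edge, \<open>M\<close> would already be a matching of size
      \<open>s\<close> in \<open>H\<close>.\<close>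
    have "{u, v} \<in> M"
      using M0 M(2) noH unfolding M0_def by (metis Diff_insert0 Diff_empty)
    then have sM0: "s = Suc (card M0)"
      using M(2) matchingD(1)[OF H M0] card_Suc_Diff1[of M "{u, v}"] by (simp add: M0_def)
    have "u \<notin> \<Union>M0" "v \<notin> \<Union>M0"
      using matching_not_in_Union_Diff[OF M(1) \<open>{u, v} \<in> M\<close>] unfolding M0_def by blast+
    \<comment> \<open>\<open>M0\<close> has size \<open>s - 1\<close>, misses \<open>u\<close> and
      \<open>v\<close>, and \<open>H\<close> has no matching with one more edge.\<close>
    then show "card (parcs H `` {u}) + card (parcs H `` {v}) + 2 \<le> 2 * s"
      using degree_sum_le_of_unmatched[OF H M0 _ uvE(3)] noH sM0 by auto
  qed
qed

section \<open>Connectivity and complements\<close>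

text \<open>A set that no arc leaves contains everything reachable from its members. Connectedness
  refers to the symmetric closure, which adds no arcs here.\<close>

lemma connected_arc_across:
  assumes G: "pair_graph G" and con: "Digraph_Component.connected (with_proj G)"
    and ab: "a \<in> pverts G" "a \<in> S" "b \<in> pverts G" "b \<notin> S"
  obtains u v where "(u, v) \<in> parcs G" "u \<in> S" "v \<notin> S"
proof (rule ccontr)
  note crossing = that
  assume "\<not> thesis"
  then have closed: "v \<in> S" if "(u, v) \<in> parcs G" "u \<in> S" for u v
    using that crossing by blast
  have "parcs (mk_symmetric (with_proj G)) = parcs G"
    using pair_graphD(5)[OF G] by (auto simp: parcs_mk_symmetric)
  then have "(a, b) \<in> rtrancl_on (pverts G) (parcs G)"
    using con ab
    by (simp add: Digraph_Component.connected_def strongly_connected_def reachable_def)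
  then have "b \<in> S"
    by (induction rule: rtrancl_on_induct) (use ab closed in auto)
  then show False using ab by simp
qed

lemma complement_degree:
  assumes G: "pair_graph G" and v: "v \<in> pverts G"
  shows "card (parcs (complement G) `` {v}) + card (parcs G `` {v}) + 1 = card (pverts G)"
proof -
  note D = pair_graphD[OF G]
  have "parcs (complement G) `` {v} \<union> parcs G `` {v} = pverts G - {v}"
    using v D(4) D(6)[of v v] by (auto simp: complement_def)
  moreover have "parcs (complement G) `` {v} \<inter> parcs G `` {v} = {}"
    by (auto simp: complement_def)
  moreover have "finite (parcs (complement G) `` {v})" "finite (parcs G `` {v})"
    using D by (auto simp: complement_def intro: finite_subset[OF _ D(1)])
  ultimately have "card (parcs (complement G) `` {v}) + card (parcs G `` {v}) = card (pverts G - {v})"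
    by (metis card_Un_disjoint)
  then show ?thesis
    using v D(1) by (simp add: card_Diff_singleton) (metis Suc_pred card_gt_0_iff empty_iff)
qed

lemma pair_graph_complement: "pair_graph G \<Longrightarrow> pair_graph (complement G)"
  by (auto simp: pair_graph_iff complement_def sym_def irrefl_def)


section \<open>Extremal structure of the complement\<close>

text \<open>With the square roots of the degrees as test vector, the squared norm is the number of
  arcs and each arc contributes at least \<open>sqrt d\<close>. The upper bound on
  \<open>mu K\<close> then forces every arc of \<open>H\<close> to contribute exactly
  \<open>sqrt d\<close>.\<close>

lemma degree_product_eq_of_mu_le:
  fixes d :: real
  assumes H: "pair_graph H" and K: "pair_graph K" "pverts K = pverts H" "parcs H \<subseteq> parcs K"
    and mu: "mu K \<le> sqrt d"
    and ge: "\<And>u v. (u, v) \<in> parcs H \<Longrightarrow>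
      d \<le> real (card (parcs H `` {u})) * real (card (parcs H `` {v}))"
    and uv: "(u, v) \<in> parcs H"
  shows "real (card (parcs H `` {u})) * real (card (parcs H `` {v})) = d"
proof -
  note D = pair_graphD[OF H]
  define f where "f w = sqrt (real (card (parcs H `` {w})))" for w
  have f: "f x * f y = sqrt (real (card (parcs H `` {x})) * real (card (parcs H `` {y})))" for x y
    by (simp add: f_def real_sqrt_mult)
  have "parcs H = (SIGMA w:pverts H. parcs H `` {w})"
    using D(3) by auto
  then have "card (parcs H) = (\<Sum>w \<in> pverts H. card (parcs H `` {w}))"
    by (metis card_SigmaI D(1,2) finite_Image)
  then have sq: "(\<Sum>w \<in> pverts H. (f w)\<^sup>2) = real (card (parcs H))"
    by (simp add: f_def)
  have nonneg: "f x * f y \<ge> 0" for x y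
    by (simp add: f_def)
  \<comment> \<open>The degrees are those of the subgraph \<open>H\<close>, but the form is that of
    \<open>K\<close>; its additional arcs contribute nonnegative terms.\<close>
  have "(\<Sum>(x, y) \<in> parcs H. f x * f y) \<le> (\<Sum>(x, y) \<in> parcs K. f x * f y)"
    using K(3) pair_graphD(2)[OF K(1)] nonneg by (intro sum_mono2) auto
  also have "\<dots> \<le> mu K * (\<Sum>w \<in> pverts K. (f w)\<^sup>2)"
    using uv D(3) K(2) by (intro sum_arcs_le_mu K(1)) auto
  also have "\<dots> \<le> sqrt d * real (card (parcs H))"
    using mu by (simp add: K(2) sq mult_right_mono)
  also have "\<dots> = (\<Sum>(x, y) \<in> parcs H. sqrt d)"
    by simp
  finally have le: "(\<Sum>(x, y) \<in> parcs H. f x * f y) \<le> (\<Sum>(x, y) \<in> parcs H. sqrt d)" .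
  have "sqrt d \<le> f x * f y" if "(x, y) \<in> parcs H" for x y
    unfolding f using ge[OF that] by simp
  then have "(\<Sum>(x, y) \<in> parcs H. f x * f y - sqrt d) = 0"
    using le by (intro antisym sum_nonneg) (auto simp: case_prod_unfold sum_subtractf)
  moreover have "\<forall>e \<in> parcs H. (case e of (x, y) \<Rightarrow> f x * f y - sqrt d) \<ge> 0"
    using \<open>\<And>x y. (x, y) \<in> parcs H \<Longrightarrow> sqrt d \<le> f x * f y\<close> by auto
  ultimately have "\<forall>e \<in> parcs H. (case e of (x, y) \<Rightarrow> f x * f y - sqrt d) = 0"
    using sum_nonneg_eq_0_iff[OF D(2)] by blast
  then have "f u * f v = sqrt d"
    using uv by auto
  then show ?thesis
    unfolding f by simp
qed

text \<open>The minimum degree leaves a vertex at most \<open>n - k - 1\<close> non-neighbours in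
  \<open>G\<close>, so \<open>C\<close> contains every non-edge at the vertices it touches. These
  vertices therefore induce a regular graph and are joined to all remaining vertices, among which
  the edges are arbitrary.\<close>

lemma in_EP_of_regular_complement:
  assumes G: "pair_graph G" and n: "card (pverts G) = n" and k: "k < n"
    and deg: "\<And>v. v \<in> pverts G \<Longrightarrow> card (parcs G `` {v}) \<ge> k"
    and C: "sym C" "C \<noteq> {}" "C \<subseteq> parcs (complement G)"
    and reg: "\<And>v. v \<in> Domain C \<Longrightarrow> card (C `` {v}) = n - k - 1"
  shows "G \<in> EP n k"
proof -
  note D = pair_graphD[OF G]
  note Dc = pair_graphD[OF pair_graph_complement[OF G]]
  have Vc: "pverts (complement G) = pverts G"
    by (simp add: complement_def)
  define V1 where "V1 = Domain C"
  define V2 where "V2 = pverts G - V1"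
  have V1: "V1 \<subseteq> pverts G"
    using C Dc(3) by (auto simp: V1_def Vc)
  have V2: "finite V2" and V12: "pverts G = V1 \<union> V2" "V1 \<inter> V2 = {}"
    using V1 D(1) by (auto simp: V2_def)
  have finV1: "finite V1"
    using V1 D(1) finite_subset by blast
  have C_Image: "C `` {v} \<subseteq> V1 - {v}" for v
    using C Dc(6) by (auto simp: V1_def dest: symD)
  have full: "parcs (complement G) `` {v} = C `` {v}" if v: "v \<in> V1" for v
  proof (rule card_seteq[symmetric])
    show "finite (parcs (complement G) `` {v})"
      using Dc(2) by (rule finite_Image)
    show "C `` {v} \<subseteq> parcs (complement G) `` {v}"
      using C(3) by auto
    show "card (parcs (complement G) `` {v}) \<le> card (C `` {v})"
      using complement_degree[OF G, of v] deg[of v] reg[of v] v V1 n by (auto simp: V1_def)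
  qed
  have arc: "(u, w) \<in> parcs G \<longleftrightarrow> (u, w) \<notin> C \<and> u \<noteq> w" if "u \<in> V1" "w \<in> pverts G" for u w
  proof -
    have "(u, w) \<in> C \<longleftrightarrow> (u, w) \<in> parcs (complement G)"
      using full[OF that(1)] by blast
    then show ?thesis
      using that V1 D(6) by (auto simp: complement_def)
  qed
  obtain v0 where v0: "v0 \<in> V1"
    using C(2) by (auto simp: V1_def)
  have "n - k - 1 \<le> card (V1 - {v0})"
    using reg[of v0] v0 card_mono[OF _ C_Image[of v0]] finV1 by (simp add: V1_def)
  then have large: "n - k \<le> card V1"
    using v0 finV1 k card_gt_0_iff[of V1] by auto
  have cV: "card V1 + card V2 = n"
    using card_Un_disjoint[of V1 V2] finV1 V2 V12 n by simp
  \<comment> \<open>By \<open>large\<close> the subtraction is not truncated. This is also the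
    degree \<open>card V1 - 1 - (n - k - 1)\<close> inside \<open>V1\<close>.\<close>
  define r where "r = card V1 + k - n"
  have r: "r \<le> k" "card V1 = n - k + r" "card V2 = k - r"
    using large cV k by (auto simp: r_def)
  define G1 where "G1 = \<lparr>pverts = V1, parcs = parcs G \<inter> V1 \<times> V1\<rparr>"
  define G2 where "G2 = \<lparr>pverts = V2, parcs = parcs G \<inter> V2 \<times> V2\<rparr>"
  define K where "K = \<lparr>pverts = V2, parcs = {(u, v). (u, v) \<in> V2 \<times> V2 \<and> u \<noteq> v}\<rparr>"
  have G12: "pair_graph G1" "pair_graph G2"
    using G finV1 V2 by (auto simp: pair_graph_iff G1_def G2_def sym_def irrefl_def)
  have K: "complete_digraph (k - r) (with_proj K)"
    using V2 r by (simp add: complete_digraph_pair_def K_def)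
  have Kg: "pair_graph K"
    using V2 by (auto simp: pair_graph_iff K_def sym_def irrefl_def)
  have span: "spanning (with_proj G2) (with_proj K)"
  proof -
    interpret G2: pair_graph G2 by (rule G12)
    interpret K: pair_graph K by (rule Kg)
    have "wf_digraph (with_proj G2)" "wf_digraph (with_proj K)"
      by unfold_locales
    then show ?thesis
      using D(6) by (auto simp: spanning_def subgraph_def compatible_def G2_def K_def)
  qed
  have "card (parcs G1 `` {v}) = r" if v: "v \<in> V1" for v
  proof -
    have "parcs G1 `` {v} = (V1 - {v}) - C `` {v}"
      using v arc V1 by (auto simp: G1_def)
    then have "card (parcs G1 `` {v}) = card V1 - 1 - (n - k - 1)"
      using finV1 v C_Image[of v] reg[of v]
      by (simp add: card_Diff_subset finite_subset V1_def[symmetric] card_Diff_singleton)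
    then show ?thesis
      using large k by (simp add: r_def)
  qed
  then have regG1: "regular r G1"
    by (simp add: regular_def out_degree_eq_card_Image G1_def)
  have across: "(u, w) \<in> parcs G" "(w, u) \<in> parcs G" if "u \<in> V1" "w \<in> V2" for u w
  proof -
    have "(u, w) \<notin> C"
      using C_Image[of u] that V12(2) by auto
    then show "(u, w) \<in> parcs G"
      using arc that V12 by auto
    then show "(w, u) \<in> parcs G" by (rule D(5))
  qed
  have "G = graph_join G1 G2"
  proof (rule pair_pre_digraph.equality)
    show "parcs G = parcs (graph_join G1 G2)"
      using D(3,4) V12(1) across by (auto simp: graph_join_def G1_def G2_def)
  qed (simp_all add: graph_join_def G1_def G2_def V12(1))
  moreover have "card (pverts G1) = n - k + r" "pverts G1 \<inter> pverts G2 = {}"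
    using r V12(2) by (auto simp: G1_def G2_def)
  ultimately show ?thesis
    unfolding EP_def using n r(1) G12 regG1 K span by blast
qed

text \<open>As \<open>a\<close> and \<open>b\<close> differ, \<open>C\<close> joins only vertices of
  degree \<open>a\<close> to vertices of degree \<open>b\<close>. One neighbourhood on each side
  already accounts for \<open>a + b\<close> vertices, hence for all of them, so \<open>C\<close> is
  complete bipartite and no edge of \<open>G\<close> can cross.\<close>

lemma disconnected_of_biregular_complement:
  assumes G: "pair_graph G" and C: "pair_graph C" "pverts C = pverts G"
      "parcs C \<subseteq> parcs (complement G)" "parcs C \<noteq> {}"
    and ab: "a < b" "card (pverts G) \<le> a + b"
    and deg: "\<And>u v. (u, v) \<in> parcs C \<Longrightarrow>
      {card (parcs C `` {u}), card (parcs C `` {v})} = {a, b}"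
  shows "\<not> Digraph_Component.connected (with_proj G)"
proof
  assume con: "Digraph_Component.connected (with_proj G)"
  note D = pair_graphD[OF C(1)]
  define A where "A = {v \<in> pverts G. card (parcs C `` {v}) = a}"
  define B where "B = {v \<in> pverts G. card (parcs C `` {v}) = b}"
  have fin: "finite A" "finite B"
    using pair_graphD(1)[OF G] by (auto simp: A_def B_def)
  have nbs: "u \<in> A \<Longrightarrow> parcs C `` {u} \<subseteq> B" "u \<in> B \<Longrightarrow> parcs C `` {u} \<subseteq> A" for u
    using deg D(4) ab(1) by (auto simp: A_def B_def C(2) doubleton_eq_iff)
  obtain x y where "(x, y) \<in> parcs C"
    using C(4) by auto
  then obtain u v where u: "u \<in> A" and v: "v \<in> B"
    using deg[of x y] D(3,4)[of x y] by (auto simp: A_def B_def C(2) doubleton_eq_iff)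
  have "a \<le> card B" "b \<le> card A"
    using card_mono[OF fin(2) nbs(1)[OF u]] card_mono[OF fin(1) nbs(2)[OF v]] u v
    by (auto simp: A_def B_def)
  moreover have AB: "A \<inter> B = {}" "A \<union> B \<subseteq> pverts G"
    using ab by (auto simp: A_def B_def)
  then have "card A + card B \<le> card (pverts G)"
    by (metis card_Un_disjoint card_mono fin pair_graphD(1)[OF G])
  ultimately have cA: "card A = b" and "card (A \<union> B) = card (pverts G)"
    using ab AB fin by (auto simp: card_Un_disjoint)
  then have V: "A \<union> B = pverts G"
    using AB(2) pair_graphD(1)[OF G] card_subset_eq by blast
  \<comment> \<open>The \<open>b\<close> neighbours of \<open>w\<close> lie in \<open>A\<close>,
    which has exactly \<open>b\<close> elements.\<close>
  have full: "parcs C `` {w} = A" if "w \<in> B" for w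
    using nbs(2)[OF that] fin(1) cA that by (intro card_subset_eq) (auto simp: B_def)
  obtain p q where pq: "(p, q) \<in> parcs G" "p \<in> A" "q \<notin> A"
    using connected_arc_across[OF G con, of u A v] u v AB by blast
  then have "q \<in> B"
    using V pair_graphD(4)[OF G] by blast
  then have "(q, p) \<in> parcs (complement G)"
    using full[of q] pq(2) C(3) by blast
  then show False
    using pq(1) pair_graphD(5)[OF G] by (auto simp: complement_def)
qed

section \<open>Degree products and the final case distinction\<close>

text \<open>The difference \<open>x * y - a * b\<close> splits into two nonnegative terms; in the
  case of equality both vanish.\<close>

lemma product_ge_extremal:
  fixes x y a b :: real
  assumes "x \<le> b" "y \<le> b" "a + b \<le> x + y" "0 < b"
  shows "a * b \<le> x * y" "x * y = a * b \<Longrightarrow> x = b \<and> y = a \<or> x = a \<and> y = b"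
proof -
  have id: "x * y - a * b = b * (x + y - (a + b)) + (b - x) * (b - y)"
    by (simp add: algebra_simps)
  have nn: "0 \<le> b * (x + y - (a + b))" "0 \<le> (b - x) * (b - y)"
    using assms by auto
  show "a * b \<le> x * y"
    using id nn by linarith
  assume "x * y = a * b"
  then have "b * (x + y - (a + b)) = 0" "(b - x) * (b - y) = 0"
    using id nn by linarith+
  then show "x = b \<and> y = a \<or> x = a \<and> y = b"
    using assms(4) by auto
qed

theorem theorem3p3:
  fixes G :: "'a pair_pre_digraph" and n k \<beta> :: nat
  assumes "k \<ge> 1" and "k \<ge> 2 * \<beta>" and "\<beta> \<le> n"
    and "n \<ge> 2 * k + \<beta> + 2" and "n mod 2 = \<beta> mod 2"
    and "pair_graph G" and "Digraph_Component.connected (with_proj G)"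
    and "card (pverts G) = n" and "min_degree G \<ge> k"
    and "mu (complement G) \<le> sqrt ((real \<beta> + real k + 1) * (real n - real k - 1))"
  shows "deficient \<beta> G \<or> G \<in> EP n k \<or>
    (\<beta> = 0 \<and> is_union_of_complete (k + 1) (n - k - 1) G)"
proof (rule disjCI)
  note G = \<open>pair_graph G\<close> and cardV = \<open>card (pverts G) = n\<close>
  assume not: "\<not> (G \<in> EP n k \<or> (\<beta> = 0 \<and> is_union_of_complete (k + 1) (n - k - 1) G))"
  have "even (n - \<beta>)"
    using assms(3,5) by (simp add: mod_eq_dvd_iff_nat)
  \<comment> \<open>By parity, a matching of size \<open>s\<close> leaves exactly \<beta> vertices
    uncovered.\<close>
  then obtain s where s: "n - \<beta> = 2 * s" by blast
  show "deficient \<beta> G"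
  proof (rule ccontr)
    assume "\<not> deficient \<beta> G"
    then have "\<nexists>M. matching G M \<and> card M = s"
      using deficiency_le[OF G] s cardV assms(3) by (force simp: deficient_def)
    moreover have "2 * s \<le> card (pverts G)"
      using s cardV by simp
    ultimately obtain H where H: "pair_graph H" "pverts H = pverts G" "parcs G \<subseteq> parcs H"
      and ne: "parcs (complement H) \<noteq> {}"
      and sumH: "\<And>u v. (u, v) \<in> parcs (complement H) \<Longrightarrow>
        card (parcs H `` {u}) + card (parcs H `` {v}) + 2 \<le> 2 * s"
      by (rule edge_maximal_without_matching[OF G]) (rule that)
    define C where "C = complement H"
    define d where "d v = card (parcs C `` {v})" for v
    define a where "a = \<beta> + k + 1"
    define b where "b = n - k - 1"
    \<comment> \<open>The lower bound on \<open>n\<close> is precisely \<open>a \<le> b\<close>, and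
      \<open>a * b\<close> is the quantity under the root in the spectral bound.\<close>
    have ab: "a \<le> b" "a + b = n + \<beta>" "real a = real \<beta> + real k + 1" "real b = real n - real k - 1"
      using assms(4) by (auto simp: a_def b_def of_nat_diff)
    have C: "pair_graph C" "pverts C = pverts G" "parcs C \<subseteq> parcs (complement G)"
      using H pair_graph_complement[OF H(1)] by (auto simp: C_def complement_def)
    note DC = pair_graphD[OF C(1)]
    have degG: "k \<le> card (parcs G `` {v})" if "v \<in> pverts G" for v
    proof -
      have "min_degree G \<le> card (parcs G `` {v})"
        unfolding min_degree_def out_degree_eq_card_Image
        using that pair_graphD(1)[OF G] by (intro Min_le) auto
      then show ?thesis
        using \<open>min_degree G \<ge> k\<close> by simp
    qed
    have dC: "d v + card (parcs H `` {v}) + 1 = n" if "v \<in> pverts G" for v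
      using complement_degree[OF H(1)] that H(2) cardV by (simp add: C_def d_def)
    have d_le: "d v \<le> b" if v: "v \<in> pverts G" for v
    proof -
      have "card (parcs G `` {v}) \<le> card (parcs H `` {v})"
        using H(3) pair_graphD(2)[OF H(1)] by (intro card_mono finite_Image) auto
      then show ?thesis
        using degG[OF v] dC[OF v] by (simp add: b_def)
    qed
    \<comment> \<open>The degrees in \<open>H\<close> add up to at most
      \<open>2 * s - 2 = n - \<beta> - 2\<close>, so those in the complement add up to at least
      \<open>2 * (n - 1) - (n - \<beta> - 2) = n + \<beta>\<close>.\<close>
    have d_sum: "a + b \<le> d u + d v" if uv: "(u, v) \<in> parcs C" for u v
    proof -
      have "u \<in> pverts G" "v \<in> pverts G"
        using DC(3,4)[OF uv] C(2) by auto
      then show ?thesis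
        using dC[of u] dC[of v] sumH[of u v] uv s assms(3) ab(2) by (simp add: C_def)
    qed
    have reals: "real (d u) \<le> real b" "real (d v) \<le> real b" "real a + real b \<le> real (d u) + real (d v)"
      "0 < real b" if uv: "(u, v) \<in> parcs C" for u v
      using d_le[of u] d_le[of v] d_sum[OF uv] DC(3,4)[OF uv] C(2) ab(1)
      by (auto simp: a_def simp flip: of_nat_add)
    have "real (d u) * real (d v) = real a * real b" if "(u, v) \<in> parcs C" for u v
      unfolding d_def
    proof (rule degree_product_eq_of_mu_le[OF C(1) pair_graph_complement[OF G] _ C(3) _ _ that])
      show "pverts (complement G) = pverts C"
        by (simp add: C(2)) (simp add: complement_def)
      show "mu (complement G) \<le> sqrt (real a * real b)"
        using assms(10) by (simp add: ab)
      show "real a * real b \<le> real (card (parcs C `` {x})) * real (card (parcs C `` {y}))"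
        if "(x, y) \<in> parcs C" for x y
        using product_ge_extremal(1)[OF reals[OF that]] by (simp add: d_def)
    qed
    then have extremal: "d u = b \<and> d v = a \<or> d u = a \<and> d v = b" if "(u, v) \<in> parcs C" for u v
      using product_ge_extremal(2)[OF reals[OF that]] that by simp
    show False
    proof (cases "a = b")
      \<comment> \<open>Every non-isolated vertex of \<open>C\<close> now has degree
        \<open>b = n - k - 1\<close>.\<close>
      case True
      have "G \<in> EP n k"
      proof (rule in_EP_of_regular_complement[OF G cardV _ degG _ _ C(3)])
        show "k < n" using assms(4) by simp
        show "sym (parcs C)" using C(1) by (simp add: pair_graph_iff)
        show "parcs C \<noteq> {}" using ne by (simp add: C_def)
        show "card (parcs C `` {v}) = n - k - 1" if "v \<in> Domain (parcs C)" for v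
          using that extremal True by (auto simp: d_def b_def)
      qed
      then show False using not by simp
    next
      case False
      then have "a < b" using ab(1) by simp
      have "\<not> Digraph_Component.connected (with_proj G)"
      proof (rule disconnected_of_biregular_complement[OF G C])
        show "parcs C \<noteq> {}" using ne by (simp add: C_def)
        show "a < b" by fact
        show "card (pverts G) \<le> a + b" using ab(2) cardV by simp
        show "{card (parcs C `` {u}), card (parcs C `` {v})} = {a, b}" if "(u, v) \<in> parcs C" for u v
          using extremal[OF that] by (auto simp: d_def)
      qed
      then show False using assms(7) by simp
    qed
  qed
qed

end
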